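(* Let $(\mathcal K,r_n)$ and $(\mathcal K,r_n')$ be pre-extenders of the $n$-maniplex $\mathcal K$. The following are equivalent: (1) there is an isomorphism $\varphi:\mathcal U(\mathcal K,r_n)\to\mathcal U(\mathcal K,r_n')$; (2) there is a non-empty $(r_n,r_n')$-friendly set $S\subseteq\Gamma(\mathcal K)$; (3) there is an automorphism $\tau$ of $\mathcal K$ such that $\mathcal K_{r_n^\tau}/\heartsuit(\mathcal K,r_n)^\tau=\mathcal K_{r_n'}/\heartsuit(\mathcal K,r_n')$ (equality, not merely isomorphism, of quotient premaniplexes on the flag set of $\mathcal K$).
   Context: An $n$-premaniplex is a graph (semi-edges and parallel edges allowed) whose vertices, called flags, carry a proper edge colouring with colours $0,\dots,n-1$, each flag $\Phi$ having exactly one incident dart of each colour $i$, with other end $r_i\Phi$; one requires $r_ir_jr_ir_j=1$ for $|i-j|>1$. An $n$-maniplex is a connected $n$-premaniplex in which $r_i$ and $r_ir_j$ ($i\ne j$) have no fixed points. Facets are components after deleting colour-$(n-1)$ edges. Automorphisms are colour-preserving and act on the right; $\Gamma(\mathcal K)$ is the automorphism group. A pre-extender $(\mathcal K,r_n)$ is a permutation $r_n$ of the flags of $\mathcal K$ with $r_n^2=1$ commuting with $r_0,\dots,r_{n-2}$. The pre-extension $\mathcal K_{r_n}$ is the $(n+1)$-premaniplex with the flags and $i$-adjacencies ($i<n$) of $\mathcal K$ and $n$-adjacency $\Phi\mapsto r_n\Phi$. The universal Cayley extension $\mathcal U(\mathcal K,r_n)$ has flags $(\Phi,\gamma)$, $\gamma\in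 G(\mathcal K,r_n)=\langle\alpha_F\ (F\text{ a facet})\mid\alpha_F\alpha_{r_n(F)}=1\rangle$, with $(\Phi,\gamma)$ $i$-adjacent to $(r_i\Phi,\gamma)$ for $i<n$ and $n$-adjacent to $(r_n\Phi,\alpha_F\gamma)$, $F$ the facet of $\Phi$. For pre-extenders $r_n,r_n'$, a set $S\subseteq\Gamma(\mathcal K)$ is $(r_n,r_n')$-friendly if for every flag $\Phi$ and every $\tau\in S$ there is $\bar\tau\in S$ with $r_n'(\Phi\tau)=(r_n\Phi)\bar\tau$; $r_n$-friendly means $(r_n,r_n)$-friendly. $\heartsuit(\mathcal K,r_n)$ is the union of all $r_n$-friendly subsets of $\Gamma(\mathcal K)$ (a subgroup). For $\tau\in\Gamma(\mathcal K)$, $r_n^\tau(\Phi)=(r_n(\Phi\tau^{-1}))\tau$ and $H^\tau=\tau^{-1}H\tau$. For an $r_n$-friendly subgroup $H$, $\mathcal K_{r_n}/H$ is the premaniplex with vertices the orbits $\Phi H$, where $\Phi H$ is $i$-adjacent to $(r_i\Phi)H$ for $0\le i\le n$. *)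

theory Defs
  imports "HOL-Algebra.Bij"
begin

section \<open>Premaniplexes and maniplexes\<close>

text \<open>
  A premaniplex of rank \<open>n\<close> is given by its flags and, for every colour \<open>i < n\<close>, the map \<open>r\<^sub>i\<close>
  sending a flag to the other end of its dart of colour \<open>i\<close>. A fixed point of \<open>r\<^sub>i\<close> is a
  semi-edge; parallel edges arise when \<open>r\<^sub>i\<close> and \<open>r\<^sub>j\<close> agree at a flag.
  The values of \<open>adj\<close> on other colours, or outside \<open>flags\<close>, carry no meaning.
\<close>

record 'f colored_graph =
  mrank :: nat
  flags :: "'f set"
  adj :: "nat \<Rightarrow> 'f \<Rightarrow> 'f"

definition premaniplex :: "nat \<Rightarrow> ('f, 'm) colored_graph_scheme \<Rightarrow> bool" where
  "premaniplex n M \<longleftrightarrow>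
     mrank M = n \<and>
     (\<forall>i<n. adj M i \<in> flags M \<rightarrow> flags M) \<and>
     (\<forall>i<n. \<forall>\<Phi>\<in>flags M. adj M i (adj M i \<Phi>) = \<Phi>) \<and>
     (\<forall>i<n. \<forall>j<n. \<bar>int i - int j\<bar> > 1 \<longrightarrow>
        (\<forall>\<Phi>\<in>flags M. adj M i (adj M j (adj M i (adj M j \<Phi>))) = \<Phi>))"

text \<open>The component of \<open>\<Phi>\<close> in the subgraph formed by the edges with colours in \<open>I\<close>.\<close>

definition component :: "('f, 'm) colored_graph_scheme \<Rightarrow> nat set \<Rightarrow> 'f \<Rightarrow> 'f set" where
  "component M I \<Phi> = {(x, adj M i x) | x i. x \<in> flags M \<and> i \<in> I}\<^sup>* `` {\<Phi>}"

definition connected_graph :: "('f, 'm) colored_graph_scheme \<Rightarrow> bool" where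
  "connected_graph M \<longleftrightarrow>
     flags M \<noteq> {} \<and> (\<forall>\<Phi>\<in>flags M. component M {..<mrank M} \<Phi> = flags M)"

definition maniplex :: "nat \<Rightarrow> ('f, 'm) colored_graph_scheme \<Rightarrow> bool" where
  "maniplex n M \<longleftrightarrow>
     premaniplex n M \<and> connected_graph M \<and>
     (\<forall>i<n. \<forall>\<Phi>\<in>flags M. adj M i \<Phi> \<noteq> \<Phi>) \<and>
     (\<forall>i<n. \<forall>j<n. i \<noteq> j \<longrightarrow> (\<forall>\<Phi>\<in>flags M. adj M i (adj M j \<Phi>) \<noteq> \<Phi>))"

definition facet_of :: "('f, 'm) colored_graph_scheme \<Rightarrow> 'f \<Rightarrow> 'f set" where
  "facet_of M \<Phi> = component M {i. Suc i < mrank M} \<Phi>"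

definition facets :: "('f, 'm) colored_graph_scheme \<Rightarrow> 'f set set" where
  "facets M = facet_of M ` flags M"

definition graph_iso ::
  "('f, 'm) colored_graph_scheme \<Rightarrow> ('g, 'k) colored_graph_scheme \<Rightarrow> ('f \<Rightarrow> 'g) set" where
  "graph_iso M N = {\<phi>. mrank M = mrank N \<and> bij_betw \<phi> (flags M) (flags N) \<and>
     (\<forall>i<mrank M. \<forall>\<Phi>\<in>flags M. \<phi> (adj M i \<Phi>) = adj N i (\<phi> \<Phi>))}"

text \<open>
  Automorphisms act on the right, so \<open>\<Phi>\<tau>\<close> is \<open>\<tau> \<Phi>\<close> and the product \<open>\<sigma>\<tau>\<close> is the map
  \<open>\<sigma>\<close> followed by \<open>\<tau>\<close>. They are extensional outside \<open>flags M\<close>.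
\<close>

definition aut_group :: "('f, 'm) colored_graph_scheme \<Rightarrow> ('f \<Rightarrow> 'f) monoid" where
  "aut_group M = \<lparr>carrier = Bij (flags M) \<inter> graph_iso M M,
                  mult = (\<lambda>\<sigma> \<tau>. compose (flags M) \<tau> \<sigma>),
                  one = (\<lambda>\<Phi>\<in>flags M. \<Phi>)\<rparr>"

definition orbit_of :: "('f \<Rightarrow> 'f) set \<Rightarrow> 'f \<Rightarrow> 'f set" where
  "orbit_of H \<Phi> = (\<lambda>\<tau>. \<tau> \<Phi>) ` H"

definition conj_set :: "('a, 'm) monoid_scheme \<Rightarrow> 'a set \<Rightarrow> 'a \<Rightarrow> 'a set" where
  "conj_set G H \<tau> = (\<lambda>h. inv\<^bsub>G\<^esub> \<tau> \<otimes>\<^bsub>G\<^esub> h \<otimes>\<^bsub>G\<^esub> \<tau>) ` H"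

text \<open>
  The union in \<open>adj\<close> is over all representatives of the orbit \<open>X\<close>; see \<open>adj_quotient\<close> below.
  The adjacency maps are restricted to the relevant colours and orbits, so that equality of two
  such records is exactly equality of the quotient premaniplexes.
\<close>

definition quotient_graph :: "'f colored_graph \<Rightarrow> ('f \<Rightarrow> 'f) set \<Rightarrow> 'f set colored_graph" where
  "quotient_graph M H =
     \<lparr>mrank = mrank M,
      flags = orbit_of H ` flags M,
      adj = (\<lambda>i\<in>{..<mrank M}. \<lambda>X\<in>orbit_of H ` flags M. \<Union>\<Phi>\<in>X. orbit_of H (adj M i \<Phi>))\<rparr>"

section \<open>Groups given by generators and relators\<close>

text \<open>
  A word is a list of letters \<open>(x, b)\<close>, where \<open>(x, True)\<close> stands for the generator \<open>x\<close> and
  \<open>(x, False)\<close> for its inverse. Two words are related if they can be transformed into each other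
  by inserting and deleting relators and pairs of mutually inverse letters.
\<close>

inductive_set word_rel :: "'a set \<Rightarrow> ('a \<times> bool) list set \<Rightarrow> (('a \<times> bool) list \<times> ('a \<times> bool) list) set"
  for X R where
  word_refl: "w \<in> lists (X \<times> UNIV) \<Longrightarrow> (w, w) \<in> word_rel X R"
| word_sym: "(v, w) \<in> word_rel X R \<Longrightarrow> (w, v) \<in> word_rel X R"
| word_trans: "(u, v) \<in> word_rel X R \<Longrightarrow> (v, w) \<in> word_rel X R \<Longrightarrow> (u, w) \<in> word_rel X R"
| word_cancel: "u \<in> lists (X \<times> UNIV) \<Longrightarrow> v \<in> lists (X \<times> UNIV) \<Longrightarrow> x \<in> X \<Longrightarrow>
    (u @ [(x, b), (x, \<not> b)] @ v, u @ v) \<in> word_rel X R"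
| word_relator: "u \<in> lists (X \<times> UNIV) \<Longrightarrow> v \<in> lists (X \<times> UNIV) \<Longrightarrow>
    r \<in> R \<Longrightarrow> r \<in> lists (X \<times> UNIV) \<Longrightarrow> (u @ r @ v, u @ v) \<in> word_rel X R"

definition presented_group :: "'a set \<Rightarrow> ('a \<times> bool) list set \<Rightarrow> ('a \<times> bool) list set monoid" where
  "presented_group X R =
     \<lparr>carrier = lists (X \<times> UNIV) // word_rel X R,
      mult = (\<lambda>A B. \<Union>u\<in>A. \<Union>v\<in>B. word_rel X R `` {u @ v}),
      one = word_rel X R `` {[]}\<rparr>"

definition generator :: "'a set \<Rightarrow> ('a \<times> bool) list set \<Rightarrow> 'a \<Rightarrow> ('a \<times> bool) list set" where
  "generator X R x = word_rel X R `` {[(x, True)]}"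

section \<open>Pre-extenders, friendly sets and universal Cayley extensions\<close>

definition pre_extender :: "('f, 'm) colored_graph_scheme \<Rightarrow> ('f \<Rightarrow> 'f) \<Rightarrow> bool" where
  "pre_extender K r \<longleftrightarrow>
     bij_betw r (flags K) (flags K) \<and>
     (\<forall>\<Phi>\<in>flags K. r (r \<Phi>) = \<Phi>) \<and>
     (\<forall>i. Suc i < mrank K \<longrightarrow> (\<forall>\<Phi>\<in>flags K. r (adj K i \<Phi>) = adj K i (r \<Phi>)))"

definition pre_extension :: "('f, 'm) colored_graph_scheme \<Rightarrow> ('f \<Rightarrow> 'f) \<Rightarrow> 'f colored_graph" where
  "pre_extension K r =
     \<lparr>mrank = Suc (mrank K), flags = flags K,
      adj = (\<lambda>i. if i < mrank K then adj K i else r)\<rparr>"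

definition ext_relators :: "('f, 'm) colored_graph_scheme \<Rightarrow> ('f \<Rightarrow> 'f) \<Rightarrow> ('f set \<times> bool) list set" where
  "ext_relators K r = {[(F, True), (r ` F, True)] | F. F \<in> facets K}"

definition ext_group ::
  "('f, 'm) colored_graph_scheme \<Rightarrow> ('f \<Rightarrow> 'f) \<Rightarrow> ('f set \<times> bool) list set monoid" where
  "ext_group K r = presented_group (facets K) (ext_relators K r)"

definition ext_gen ::
  "('f, 'm) colored_graph_scheme \<Rightarrow> ('f \<Rightarrow> 'f) \<Rightarrow> 'f set \<Rightarrow> ('f set \<times> bool) list set" where
  "ext_gen K r F = generator (facets K) (ext_relators K r) F"

definition universal_extension ::
  "('f, 'm) colored_graph_scheme \<Rightarrow> ('f \<Rightarrow> 'f) \<Rightarrow> ('f \<times> ('f set \<times> bool) list set) colored_graph"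
  where
  "universal_extension K r =
     \<lparr>mrank = Suc (mrank K),
      flags = flags K \<times> carrier (ext_group K r),
      adj = (\<lambda>i (\<Phi>, \<gamma>).
        if i < mrank K then (adj K i \<Phi>, \<gamma>)
        else (r \<Phi>, ext_gen K r (facet_of K \<Phi>) \<otimes>\<^bsub>ext_group K r\<^esub> \<gamma>))\<rparr>"

definition friendly ::
  "('f, 'm) colored_graph_scheme \<Rightarrow> ('f \<Rightarrow> 'f) \<Rightarrow> ('f \<Rightarrow> 'f) \<Rightarrow> ('f \<Rightarrow> 'f) set \<Rightarrow> bool" where
  "friendly K r r' S \<longleftrightarrow>
     S \<subseteq> carrier (aut_group K) \<and>
     (\<forall>\<Phi>\<in>flags K. \<forall>\<tau>\<in>S. \<exists>\<tau>'\<in>S. r' (\<tau> \<Phi>) = \<tau>' (r \<Phi>))"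

definition heart :: "('f, 'm) colored_graph_scheme \<Rightarrow> ('f \<Rightarrow> 'f) \<Rightarrow> ('f \<Rightarrow> 'f) set" where
  "heart K r = \<Union>{S. friendly K r r S}"

definition conj_extender ::
  "('f, 'm) colored_graph_scheme \<Rightarrow> ('f \<Rightarrow> 'f) \<Rightarrow> ('f \<Rightarrow> 'f) \<Rightarrow> 'f \<Rightarrow> 'f" where
  "conj_extender K r \<tau> \<Phi> = \<tau> (r ((inv\<^bsub>aut_group K\<^esub> \<tau>) \<Phi>))"

section \<open>Well-definedness\<close>

lemma word_rel_lists:
  "(u, v) \<in> word_rel X R \<Longrightarrow> u \<in> lists (X \<times> UNIV) \<and> v \<in> lists (X \<times> UNIV)"
  by (induction rule: word_rel.induct) auto

lemma equiv_word_rel: "equiv (lists (X \<times> UNIV)) (word_rel X R)"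
proof (rule equivI)
  show "refl_on (lists (X \<times> UNIV)) (word_rel X R)"
    by (rule refl_onI) (rule word_rel.word_refl)
  show "word_rel X R \<subseteq> lists (X \<times> UNIV) \<times> lists (X \<times> UNIV)"
  proof (rule subrelI)
    fix u v assume "(u, v) \<in> word_rel X R"
    from word_rel_lists[OF this] show "(u, v) \<in> lists (X \<times> UNIV) \<times> lists (X \<times> UNIV)"
      by (simp only: mem_Sigma_iff)
  qed
  show "sym (word_rel X R)" by (rule symI) (rule word_rel.word_sym)
  show "trans (word_rel X R)" by (rule transI) (rule word_rel.word_trans)
qed

lemma word_rel_append_both:
  assumes "(u, v) \<in> word_rel X R" "a \<in> lists (X \<times> UNIV)" "b \<in> lists (X \<times> UNIV)"
  shows "(a @ u @ b, a @ v @ b) \<in> word_rel X R"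
  using assms(1)
proof (induction rule: word_rel.induct)
  case (word_refl w)
  then show ?case using assms by (intro word_rel.word_refl) auto
next
  case (word_cancel u v x c)
  then show ?case using assms word_rel.word_cancel[of "a @ u" X "v @ b" x c R] by simp
next
  case (word_relator u v r)
  then show ?case using assms word_rel.word_relator[of "a @ u" X "v @ b" r R] by simp
qed (blast intro: word_rel.word_sym word_rel.word_trans)+

lemma word_rel_append:
  assumes "(u, u') \<in> word_rel X R" "(v, v') \<in> word_rel X R"
  shows "(u @ v, u' @ v') \<in> word_rel X R"
  using word_rel_append_both[OF assms(1), of "[]" v] word_rel_append_both[OF assms(2), of u' "[]"]
    word_rel_lists[OF assms(1)] word_rel_lists[OF assms(2)]
  by (auto intro: word_rel.word_trans)

lemma mult_presented_group:
  assumes "u \<in> lists (X \<times> UNIV)" "v \<in> lists (X \<times> UNIV)"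
  shows "word_rel X R `` {u} \<otimes>\<^bsub>presented_group X R\<^esub> word_rel X R `` {v} = word_rel X R `` {u @ v}"
proof -
  have "word_rel X R `` {u' @ v'} = word_rel X R `` {u @ v}"
    if "(u, u') \<in> word_rel X R" "(v, v') \<in> word_rel X R" for u' v'
    by (rule sym, rule equiv_class_eq[OF equiv_word_rel]) (rule word_rel_append[OF that])
  moreover have "(u, u) \<in> word_rel X R" "(v, v) \<in> word_rel X R"
    using assms by (auto intro: word_rel.word_refl)
  ultimately have "(\<Union>u'\<in>word_rel X R `` {u}. \<Union>v'\<in>word_rel X R `` {v}. word_rel X R `` {u' @ v'})
      = word_rel X R `` {u @ v}"
    by blast
  then show ?thesis by (simp add: presented_group_def)
qed

lemma word_rel_inverse:
  "w \<in> lists (X \<times> UNIV) \<Longrightarrow> (rev (map (\<lambda>(x, b). (x, \<not> b)) w) @ w, []) \<in> word_rel X R"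
proof (induction w)
  case Nil
  then show ?case by (auto intro: word_rel.word_refl)
next
  case (Cons l w)
  obtain x b where l: "l = (x, b)" by force
  let ?u = "rev (map (\<lambda>(x, b). (x, \<not> b)) w)"
  have "?u \<in> lists (X \<times> UNIV)" "w \<in> lists (X \<times> UNIV)" "x \<in> X" using Cons.prems l by auto
  then have "(?u @ [(x, \<not> b), (x, \<not> \<not> b)] @ w, ?u @ w) \<in> word_rel X R"
    by (rule word_rel.word_cancel)
  then show ?case using Cons l by (auto intro: word_rel.word_trans)
qed

lemma group_presented_group: "group (presented_group X R)" (is "group ?G")
proof (rule groupI)
  let ?W = "lists (X \<times> (UNIV :: bool set))"
  have car: "carrier ?G = ?W // word_rel X R" and one: "\<one>\<^bsub>?G\<^esub> = word_rel X R `` {[]}"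
    by (auto simp: presented_group_def)
  note mul = mult_presented_group[of _ X _ R]
  show "\<one>\<^bsub>?G\<^esub> \<in> carrier ?G" unfolding car one by (rule quotientI) simp
  fix A assume "A \<in> carrier ?G"
  then obtain a where a: "a \<in> ?W" "A = word_rel X R `` {a}" unfolding car by (rule quotientE)
  show "\<one>\<^bsub>?G\<^esub> \<otimes>\<^bsub>?G\<^esub> A = A" using a by (simp add: one mul)
  let ?a = "rev (map (\<lambda>(x, b). (x, \<not> b)) a)"
  have "?a \<in> ?W" using a by auto
  moreover have "word_rel X R `` {?a} \<otimes>\<^bsub>?G\<^esub> A = \<one>\<^bsub>?G\<^esub>"
    using a calculation equiv_class_eq[OF equiv_word_rel word_rel_inverse[OF a(1)]]
    by (simp add: one mul)
  ultimately show "\<exists>B\<in>carrier ?G. B \<otimes>\<^bsub>?G\<^esub> A = \<one>\<^bsub>?G\<^esub>" unfolding car by (blast intro: quotientI)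
  fix B assume "B \<in> carrier ?G"
  then obtain b where b: "b \<in> ?W" "B = word_rel X R `` {b}" unfolding car by (rule quotientE)
  show "A \<otimes>\<^bsub>?G\<^esub> B \<in> carrier ?G" using a b unfolding car by (simp add: mul quotientI)
  fix C assume "C \<in> carrier ?G"
  then obtain c where c: "c \<in> ?W" "C = word_rel X R `` {c}" unfolding car by (rule quotientE)
  show "A \<otimes>\<^bsub>?G\<^esub> B \<otimes>\<^bsub>?G\<^esub> C = A \<otimes>\<^bsub>?G\<^esub> (B \<otimes>\<^bsub>?G\<^esub> C)" using a b c by (simp add: mul)
qed

lemma group_aut_group:
  assumes "premaniplex n M"
  shows "group (aut_group M)"
proof (rule groupI)
  have adjI: "adj M i \<Phi> \<in> flags M" if "i < mrank M" "\<Phi> \<in> flags M" for i \<Phi>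
    using assms that by (auto simp: premaniplex_def)
  let ?G = "aut_group M" and ?S = "flags M"
  show "\<one>\<^bsub>?G\<^esub> \<in> carrier ?G"
    using adjI by (auto simp: aut_group_def Bij_def graph_iso_def bij_betw_def inj_on_def)
  fix x assume x: "x \<in> carrier ?G"
  then have xb: "bij_betw x ?S ?S" and xe: "x \<in> extensional ?S"
    and xc: "\<And>i \<Phi>. i < mrank M \<Longrightarrow> \<Phi> \<in> ?S \<Longrightarrow> x (adj M i \<Phi>) = adj M i (x \<Phi>)"
    by (auto simp: aut_group_def Bij_def graph_iso_def)
  have xS: "x \<Phi> \<in> ?S" if "\<Phi> \<in> ?S" for \<Phi> using xb that by (auto simp: bij_betw_def)
  show "\<one>\<^bsub>?G\<^esub> \<otimes>\<^bsub>?G\<^esub> x = x"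
    using xe by (auto simp: aut_group_def compose_def fun_eq_iff extensional_def)
  define y where "y = (\<lambda>\<Phi>\<in>?S. inv_into ?S x \<Phi>)"
  have yb: "bij_betw y ?S ?S"
    unfolding y_def using bij_betw_inv_into[OF xb] by (subst bij_betw_cong[of _ _ "inv_into ?S x"]) auto
  have yS: "y \<Phi> \<in> ?S" if "\<Phi> \<in> ?S" for \<Phi> using yb that by (auto simp: bij_betw_def)
  have xy: "x (y \<Phi>) = \<Phi>" if "\<Phi> \<in> ?S" for \<Phi>
    using that bij_betw_inv_into_right[OF xb] by (simp add: y_def)
  have yx: "y (x \<Phi>) = \<Phi>" if "\<Phi> \<in> ?S" for \<Phi>
    using that bij_betw_inv_into_left[OF xb] xS by (simp add: y_def)
  have yc: "y (adj M i \<Phi>) = adj M i (y \<Phi>)" if "i < mrank M" "\<Phi> \<in> ?S" for i \<Phi>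
    using xc[OF that(1) yS[OF that(2)]] yx[OF adjI[OF that(1) yS[OF that(2)]]] xy[OF that(2)] by simp
  have "y \<in> carrier ?G"
    using yb yc by (auto simp: aut_group_def Bij_def graph_iso_def y_def)
  moreover have "y \<otimes>\<^bsub>?G\<^esub> x = \<one>\<^bsub>?G\<^esub>"
    using xy by (auto simp: aut_group_def compose_def fun_eq_iff)
  ultimately show "\<exists>y\<in>carrier ?G. y \<otimes>\<^bsub>?G\<^esub> x = \<one>\<^bsub>?G\<^esub>" by blast
  fix z assume z: "z \<in> carrier ?G"
  then have zb: "bij_betw z ?S ?S"
    and zc: "\<And>i \<Phi>. i < mrank M \<Longrightarrow> \<Phi> \<in> ?S \<Longrightarrow> z (adj M i \<Phi>) = adj M i (z \<Phi>)"
    by (auto simp: aut_group_def Bij_def graph_iso_def)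
  have "compose ?S z x \<in> Bij ?S" using x z by (auto intro!: compose_Bij simp: aut_group_def)
  then show "x \<otimes>\<^bsub>?G\<^esub> z \<in> carrier ?G"
    using xc zc xS adjI by (auto simp: aut_group_def graph_iso_def Bij_def compose_def)
  fix w assume w: "w \<in> carrier ?G"
  show "x \<otimes>\<^bsub>?G\<^esub> z \<otimes>\<^bsub>?G\<^esub> w = x \<otimes>\<^bsub>?G\<^esub> (z \<otimes>\<^bsub>?G\<^esub> w)"
    using xS by (auto simp: aut_group_def compose_def fun_eq_iff)
qed

lemma adj_quotient:
  assumes K: "premaniplex n K" and r: "pre_extender K r"
    and H: "subgroup H (aut_group K)" "friendly K r r H"
    and "i \<le> n" "\<Phi> \<in> flags K"
  shows "adj (quotient_graph (pre_extension K r) H) i (orbit_of H \<Phi>) =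
         orbit_of H (adj (pre_extension K r) i \<Phi>)"
proof -
  let ?P = "pre_extension K r"
  have n: "mrank K = n" using K by (simp add: premaniplex_def)
  have adjS: "adj ?P i \<Phi> \<in> flags K"
    using K r assms(5,6) by (auto simp: pre_extension_def premaniplex_def pre_extender_def bij_betw_def)
  have aut: "\<tau> \<in> carrier (aut_group K)" if "\<tau> \<in> H" for \<tau>
    using that H(1) subgroup.subset by blast
  have orb: "orbit_of H (\<tau> \<Psi>) = orbit_of H \<Psi>" if "\<tau> \<in> H" "\<Psi> \<in> flags K" for \<tau> \<Psi>
  proof -
    interpret group "aut_group K" using K by (rule group_aut_group)
    have mul: "(\<sigma> \<otimes>\<^bsub>aut_group K\<^esub> \<rho>) \<Psi> = \<rho> (\<sigma> \<Psi>)" for \<sigma> \<rho>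
      using that by (simp add: aut_group_def compose_def)
    have "\<rho> (\<tau> \<Psi>) \<in> orbit_of H \<Psi>" if "\<rho> \<in> H" for \<rho>
      unfolding orbit_of_def using mul[of \<tau> \<rho>] subgroup.m_closed[OF H(1) \<open>\<tau> \<in> H\<close> that]
      by (metis imageI)
    moreover have "\<rho> \<Psi> \<in> orbit_of H (\<tau> \<Psi>)" if "\<rho> \<in> H" for \<rho>
    proof -
      let ?\<sigma> = "inv\<^bsub>aut_group K\<^esub> \<tau> \<otimes>\<^bsub>aut_group K\<^esub> \<rho>"
      have s: "?\<sigma> \<in> H" using H(1) \<open>\<tau> \<in> H\<close> that by (simp add: subgroup.m_closed subgroup.m_inv_closed)
      have "\<tau> \<otimes>\<^bsub>aut_group K\<^esub> ?\<sigma> = \<rho>" using aut \<open>\<tau> \<in> H\<close> that by (simp add: m_assoc[symmetric])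
      then have "\<rho> \<Psi> = ?\<sigma> (\<tau> \<Psi>)" using mul[of \<tau> ?\<sigma>] by simp
      then show ?thesis using s unfolding orbit_of_def by blast
    qed
    ultimately show ?thesis unfolding orbit_of_def by blast
  qed
  have eq: "orbit_of H (adj ?P i (\<tau> \<Phi>)) = orbit_of H (adj ?P i \<Phi>)" if t: "\<tau> \<in> H" for \<tau>
  proof -
    have "\<exists>\<tau>'\<in>H. adj ?P i (\<tau> \<Phi>) = \<tau>' (adj ?P i \<Phi>)"
    proof (cases "i < n")
      case True
      have "\<tau> (adj K i \<Phi>) = adj K i (\<tau> \<Phi>)"
        using aut[OF t] True n assms(6) by (auto simp: aut_group_def graph_iso_def)
      then show ?thesis using t True n by (auto simp: pre_extension_def intro!: bexI[of _ \<tau>])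
    next
      case False
      then show ?thesis using H(2) t assms(6) n by (auto simp: pre_extension_def friendly_def)
    qed
    then show ?thesis using orb adjS by metis
  qed
  have ne: "H \<noteq> {}" using H(1) subgroup.one_closed by blast
  have "(\<Union>\<Psi>\<in>orbit_of H \<Phi>. orbit_of H (adj ?P i \<Psi>)) = orbit_of H (adj ?P i \<Phi>)"
    using eq ne by (simp add: orbit_of_def[of H \<Phi>])
  moreover have "i < mrank ?P" "orbit_of H \<Phi> \<in> orbit_of H ` flags ?P"
    using assms(5,6) n by (auto simp: pre_extension_def)
  ultimately show ?thesis by (simp add: quotient_graph_def)
qed

end

(*
  Deleting the edges of colour n from U(K, r) leaves one copy of K for each group element. An
  isomorphism between universal extensions permutes these copies and so induces one automorphism
  of K per copy; together they form a friendly set. Conversely, a friendly set S carries an action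
  of the group of r on pairs (element of S, element of the group of r'), and an orbit of this
  action is a homomorphism U(K, r) -> U(K, r'). The inverse set of S is (r', r)-friendly and gives
  a homomorphism back; the two compose to endomorphisms of connected graphs that fix a flag, hence
  are identities.

  Products and inverses of friendly sets are friendly, so S^-1 heart(r) S lies in heart(r') and
  conversely, which forces heart(r)^tau = heart(r') for every tau in S. From equal quotients, one
  recovers the friendly set tau heart(r').
*)

theory Submission
  imports Defs "HOL-Algebra.Coset"
begin

section \<open>Components and homomorphisms\<close>

text \<open>The maps built from friendly sets are at first only homomorphisms; bijectivity comes
  later, from a homomorphism in the opposite direction.\<close>

definition graph_hom ::
  "('f, 'm) colored_graph_scheme \<Rightarrow> ('g, 'k) colored_graph_scheme \<Rightarrow> ('f \<Rightarrow> 'g) set" where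
  "graph_hom M N = {\<phi>. mrank M = mrank N \<and> \<phi> \<in> flags M \<rightarrow> flags N \<and>
     (\<forall>i<mrank M. \<forall>\<Phi>\<in>flags M. \<phi> (adj M i \<Phi>) = adj N i (\<phi> \<Phi>))}"

lemma graph_hom_compose:
  assumes "\<phi> \<in> graph_hom L M" "\<psi> \<in> graph_hom M N"
  shows "\<psi> \<circ> \<phi> \<in> graph_hom L N"
  using assms by (auto simp: graph_hom_def Pi_iff)

lemma graph_iso_of_inverse_homs:
  assumes "\<phi> \<in> graph_hom M N" "\<psi> \<in> graph_hom N M"
    and "\<And>x. x \<in> flags M \<Longrightarrow> \<psi> (\<phi> x) = x" "\<And>y. y \<in> flags N \<Longrightarrow> \<phi> (\<psi> y) = y"
  shows "\<phi> \<in> graph_iso M N"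
proof -
  have "bij_betw \<phi> (flags M) (flags N)"
    by (rule bij_betw_byWitness[where f' = \<psi>]) (use assms in \<open>auto simp: graph_hom_def\<close>)
  then show ?thesis using assms(1) by (simp add: graph_iso_def graph_hom_def)
qed

lemma component_self: "\<Phi> \<in> component M I \<Phi>"
  by (simp add: component_def)

lemma component_step:
  assumes "\<Psi> \<in> component M I \<Phi>" "\<Psi> \<in> flags M" "i \<in> I"
  shows "adj M i \<Psi> \<in> component M I \<Phi>"
proof -
  have "(\<Phi>, \<Psi>) \<in> {(x, adj M i x) | x i. x \<in> flags M \<and> i \<in> I}\<^sup>*"
    using assms(1) by (simp add: component_def)
  then have "(\<Phi>, adj M i \<Psi>) \<in> {(x, adj M i x) | x i. x \<in> flags M \<and> i \<in> I}\<^sup>*"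
    by (rule rtrancl_into_rtrancl) (use assms in blast)
  then show ?thesis by (simp add: component_def)
qed

lemma component_induct [consumes 1, case_names self step]:
  assumes "\<Psi> \<in> component M I \<Phi>" "P \<Phi>"
    and "\<And>\<Psi> i. \<Psi> \<in> flags M \<Longrightarrow> i \<in> I \<Longrightarrow> P \<Psi> \<Longrightarrow> P (adj M i \<Psi>)"
  shows "P \<Psi>"
proof -
  have "(\<Phi>, \<Psi>) \<in> {(x, adj M i x) | x i. x \<in> flags M \<and> i \<in> I}\<^sup>*"
    using assms(1) by (simp add: component_def)
  then show ?thesis by (induction rule: rtrancl_induct) (use assms(2,3) in auto)
qed

text \<open>Paths push forward along \<open>f\<close>, and a path in \<open>N\<close> from
  \<open>f \<Phi>\<close> lifts edge by edge to a path from \<open>\<Phi>\<close>; the lifting works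
  for non-injective \<open>f\<close> as well.\<close>

lemma image_component:
  assumes f: "\<And>i \<Psi>. i \<in> I \<Longrightarrow> \<Psi> \<in> flags M \<Longrightarrow> f (adj M i \<Psi>) = adj N i (f \<Psi>)"
    and "\<And>\<Psi>. \<Psi> \<in> flags M \<Longrightarrow> f \<Psi> \<in> flags N"
    and "component M I \<Phi> \<subseteq> flags M"
  shows "f ` component M I \<Phi> = component N I (f \<Phi>)"
proof
  have "f \<Psi> \<in> component N I (f \<Phi>)" if "\<Psi> \<in> component M I \<Phi>" for \<Psi>
    using that by (induction rule: component_induct)
      (auto simp: f component_self intro!: component_step assms)
  then show "f ` component M I \<Phi> \<subseteq> component N I (f \<Phi>)" by blast
  show "component N I (f \<Phi>) \<subseteq> f ` component M I \<Phi>"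
  proof
    fix \<Psi> assume "\<Psi> \<in> component N I (f \<Phi>)"
    then show "\<Psi> \<in> f ` component M I \<Phi>"
    proof (induction rule: component_induct)
      case self
      show ?case by (simp add: component_self)
    next
      case (step \<Psi> i)
      then obtain x where "x \<in> component M I \<Phi>" "\<Psi> = f x" by blast
      then show ?case using f[of i x] step(2) assms(3) component_step[of x M I \<Phi> i] by (metis imageI subsetD)
    qed
  qed
qed

section \<open>Automorphisms of connected premaniplexes\<close>

locale connected_premaniplex =
  fixes K :: "('f, 'm) colored_graph_scheme"
  assumes premaniplex: "premaniplex (mrank K) K" and connected: "connected_graph K"
begin

abbreviation A where "A \<equiv> aut_group K"

sublocale aut: group A
  using premaniplex by (rule group_aut_group)

lemma adj_closed: "i < mrank K \<Longrightarrow> \<Phi> \<in> flags K \<Longrightarrow> adj K i \<Phi> \<in> flags K"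
  using premaniplex by (auto simp: premaniplex_def)

lemma flags_induct [consumes 2, case_names base step]:
  assumes "\<Phi> \<in> flags K" "\<Psi> \<in> flags K" "P \<Phi>"
    and "\<And>\<Psi> i. \<Psi> \<in> flags K \<Longrightarrow> i < mrank K \<Longrightarrow> P \<Psi> \<Longrightarrow> P (adj K i \<Psi>)"
  shows "P \<Psi>"
proof -
  have "\<Psi> \<in> component K {..<mrank K} \<Phi>"
    using connected assms(1,2) by (auto simp: connected_graph_def)
  then show ?thesis by (induction rule: component_induct) (use assms(3,4) in auto)
qed

lemma facet_subset: "\<Phi> \<in> flags K \<Longrightarrow> facet_of K \<Phi> \<subseteq> flags K"
proof
  fix \<Psi> assume "\<Phi> \<in> flags K" "\<Psi> \<in> facet_of K \<Phi>"
  from this(2,1) show "\<Psi> \<in> flags K"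
    unfolding facet_of_def by (induction rule: component_induct) (auto simp: adj_closed)
qed

lemma aut_closed: "\<tau> \<in> carrier A \<Longrightarrow> \<Phi> \<in> flags K \<Longrightarrow> \<tau> \<Phi> \<in> flags K"
  by (auto simp: aut_group_def graph_iso_def bij_betw_def)

lemma aut_adj:
  "\<tau> \<in> carrier A \<Longrightarrow> i < mrank K \<Longrightarrow> \<Phi> \<in> flags K \<Longrightarrow> \<tau> (adj K i \<Phi>) = adj K i (\<tau> \<Phi>)"
  by (auto simp: aut_group_def graph_iso_def)

lemma aut_mult: "\<Phi> \<in> flags K \<Longrightarrow> (\<sigma> \<otimes>\<^bsub>A\<^esub> \<tau>) \<Phi> = \<tau> (\<sigma> \<Phi>)"
  by (simp add: aut_group_def compose_def)

lemma aut_one: "\<Phi> \<in> flags K \<Longrightarrow> \<one>\<^bsub>A\<^esub> \<Phi> = \<Phi>"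
  by (simp add: aut_group_def)

lemma aut_inv:
  assumes "\<tau> \<in> carrier A" "\<Phi> \<in> flags K"
  shows "(inv\<^bsub>A\<^esub> \<tau>) (\<tau> \<Phi>) = \<Phi>" "\<tau> ((inv\<^bsub>A\<^esub> \<tau>) \<Phi>) = \<Phi>"
  using assms by (simp_all flip: aut_mult add: aut_one)

text \<open>Agreement at one flag spreads along edges by connectedness; off the flag set,
  extensionality gives both maps the same default value.\<close>

lemma aut_eqI:
  assumes "\<sigma> \<in> carrier A" "\<tau> \<in> carrier A" "\<Phi> \<in> flags K" "\<sigma> \<Phi> = \<tau> \<Phi>"
  shows "\<sigma> = \<tau>"
proof
  fix \<Psi>
  show "\<sigma> \<Psi> = \<tau> \<Psi>"
  proof (cases "\<Psi> \<in> flags K")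
    case True
    from assms(3) True show ?thesis
      by (induction rule: flags_induct) (use assms in \<open>simp_all add: aut_adj\<close>)
  next
    case False
    then show ?thesis using assms by (auto simp: aut_group_def Bij_def extensional_def)
  qed
qed

lemma aut_facet:
  assumes "\<tau> \<in> carrier A" "\<Phi> \<in> flags K"
  shows "\<tau> ` facet_of K \<Phi> = facet_of K (\<tau> \<Phi>)"
  unfolding facet_of_def
  by (rule image_component)
    (use assms facet_subset[of \<Phi>] in \<open>auto simp: aut_closed aut_adj facet_of_def\<close>)

section \<open>Pre-extenders permute the facets\<close>

lemma extender_closed: "pre_extender K r \<Longrightarrow> \<Phi> \<in> flags K \<Longrightarrow> r \<Phi> \<in> flags K"
  by (auto simp: pre_extender_def bij_betw_def)

lemma extender_invol: "pre_extender K r \<Longrightarrow> \<Phi> \<in> flags K \<Longrightarrow> r (r \<Phi>) = \<Phi>"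
  by (auto simp: pre_extender_def)

lemma extender_adj:
  "pre_extender K r \<Longrightarrow> Suc i < mrank K \<Longrightarrow> \<Phi> \<in> flags K \<Longrightarrow> r (adj K i \<Phi>) = adj K i (r \<Phi>)"
  by (auto simp: pre_extender_def)

text \<open>\<open>r\<close> commutes with the colours spanning a facet, though in general not with
  the last colour of \<open>K\<close>, so it carries components for those colours onto
  components.\<close>

lemma extender_facet:
  assumes "pre_extender K r" "\<Phi> \<in> flags K"
  shows "r ` facet_of K \<Phi> = facet_of K (r \<Phi>)"
  unfolding facet_of_def
  by (rule image_component)
    (use assms facet_subset[of \<Phi>] in \<open>auto simp: extender_closed extender_adj facet_of_def\<close>)

lemma extender_facets: "pre_extender K r \<Longrightarrow> F \<in> facets K \<Longrightarrow> r ` F \<in> facets K"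
  by (auto simp: facets_def extender_facet extender_closed)

lemma extender_facets_invol: "pre_extender K r \<Longrightarrow> F \<in> facets K \<Longrightarrow> r ` r ` F = F"
  unfolding facets_def
  by (elim imageE) (simp add: extender_facet extender_closed extender_invol del: image_image)

section \<open>Friendly sets and the heart\<close>

lemma friendly_subset: "friendly K r r' S \<Longrightarrow> S \<subseteq> carrier A"
  by (simp add: friendly_def)

lemma friendlyE:
  assumes "friendly K r r' S" "\<Phi> \<in> flags K" "\<tau> \<in> S"
  obtains \<tau>' where "\<tau>' \<in> S" "\<tau>' \<in> carrier A" "r' (\<tau> \<Phi>) = \<tau>' (r \<Phi>)"
  using assms unfolding friendly_def by (meson subsetD)

text \<open>Use friendliness of \<open>S\<close> at \<open>\<Phi>\<close>, then that of
  \<open>T\<close> at \<open>\<sigma> \<Phi>\<close>. With automorphisms on the right: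
  \<open>r''(\<Phi>\<sigma>\<tau>) = (r'(\<Phi>\<sigma>))\<tau>' =
  (r\<Phi>)\<sigma>'\<tau>'\<close>.\<close>

lemma friendly_set_mult:
  assumes S: "friendly K r r' S" and T: "friendly K r' r'' T" and r: "pre_extender K r"
  shows "friendly K r r'' (S <#>\<^bsub>A\<^esub> T)"
  unfolding friendly_def
proof (intro conjI ballI)
  show "S <#>\<^bsub>A\<^esub> T \<subseteq> carrier A"
    using S T friendly_subset aut.set_mult_closed by metis
  fix \<Phi> \<rho> assume \<Phi>: "\<Phi> \<in> flags K" and "\<rho> \<in> S <#>\<^bsub>A\<^esub> T"
  then obtain \<sigma> \<tau> where st: "\<sigma> \<in> S" "\<tau> \<in> T" "\<rho> = \<sigma> \<otimes>\<^bsub>A\<^esub> \<tau>" by (auto simp: set_mult_def)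
  obtain \<sigma>' where s': "\<sigma>' \<in> S" "r' (\<sigma> \<Phi>) = \<sigma>' (r \<Phi>)" using S \<Phi> st(1) by (rule friendlyE)
  have "\<sigma> \<Phi> \<in> flags K" using S st \<Phi> friendly_subset aut_closed by blast
  then obtain \<tau>' where t': "\<tau>' \<in> T" "r'' (\<tau> (\<sigma> \<Phi>)) = \<tau>' (r' (\<sigma> \<Phi>))"
    by (rule friendlyE[OF T _ st(2)])
  have "r'' (\<rho> \<Phi>) = (\<sigma>' \<otimes>\<^bsub>A\<^esub> \<tau>') (r \<Phi>)"
    using \<Phi> r by (simp add: st aut_mult s' t' extender_closed)
  then show "\<exists>\<rho>'\<in>S <#>\<^bsub>A\<^esub> T. r'' (\<rho> \<Phi>) = \<rho>' (r \<Phi>)"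
    using s' t' by (auto simp: set_mult_def)
qed

text \<open>At the flag \<open>\<rho> \<Psi>\<close>, friendliness of \<open>S\<close> reads
  \<open>r' \<Psi> = \<sigma> (r (\<rho> \<Psi>))\<close>; solve this for
  \<open>r (\<rho> \<Psi>)\<close>.\<close>

lemma friendly_inverse:
  assumes S: "friendly K r r' S" and r: "pre_extender K r"
  shows "friendly K r' r (m_inv A ` S)"
  unfolding friendly_def
proof (intro conjI ballI)
  have SA: "S \<subseteq> carrier A" using S by (rule friendly_subset)
  then show "m_inv A ` S \<subseteq> carrier A" by auto
  fix \<Psi> \<rho> assume \<Psi>: "\<Psi> \<in> flags K" and "\<rho> \<in> m_inv A ` S"
  then obtain \<tau> where t: "\<tau> \<in> S" "\<rho> = inv\<^bsub>A\<^esub> \<tau>" by blast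
  have t': "\<tau> \<in> carrier A" using t SA by blast
  have \<rho>: "\<rho> \<Psi> \<in> flags K" using \<Psi> t t' by (simp add: aut_closed)
  then obtain \<sigma> where s: "\<sigma> \<in> S" "\<sigma> \<in> carrier A" "r' (\<tau> (\<rho> \<Psi>)) = \<sigma> (r (\<rho> \<Psi>))"
    by (rule friendlyE[OF S _ t(1)])
  then have "r (\<rho> \<Psi>) = (inv\<^bsub>A\<^esub> \<sigma>) (r' \<Psi>)"
    using \<Psi> r \<rho> t t' by (simp add: aut_inv extender_closed)
  then show "\<exists>\<rho>'\<in>m_inv A ` S. r (\<rho> \<Psi>) = \<rho>' (r' \<Psi>)" using s by blast
qed

lemma friendly_heart: "friendly K r r (heart K r)"
  unfolding heart_def friendly_def by blast

lemma heart_upper: "friendly K r r S \<Longrightarrow> S \<subseteq> heart K r"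
  unfolding heart_def by blast

lemma one_in_heart:
  assumes "pre_extender K r"
  shows "\<one>\<^bsub>A\<^esub> \<in> heart K r"
proof -
  have "friendly K r r {\<one>\<^bsub>A\<^esub>}"
    using assms by (simp add: friendly_def aut_one extender_closed)
  then show ?thesis using heart_upper by blast
qed

lemma subgroup_heart:
  assumes r: "pre_extender K r"
  shows "subgroup (heart K r) A"
proof (rule aut.subgroupI)
  show "heart K r \<subseteq> carrier A" using friendly_heart by (rule friendly_subset)
  show "heart K r \<noteq> {}" using one_in_heart[OF r] by blast
  show "inv\<^bsub>A\<^esub> \<tau> \<in> heart K r" if "\<tau> \<in> heart K r" for \<tau>
    using heart_upper[OF friendly_inverse[OF friendly_heart r]] that by blast
  show "\<sigma> \<otimes>\<^bsub>A\<^esub> \<tau> \<in> heart K r" if "\<sigma> \<in> heart K r" "\<tau> \<in> heart K r" for \<sigma> \<tau>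
    using heart_upper[OF friendly_set_mult[OF friendly_heart friendly_heart r]] that
    by (auto simp: set_mult_def)
qed

text \<open>The product S^-1 heart(r) S is \<open>(r', r')\<close>-friendly, hence contained in the
  heart of \<open>r'\<close>. Two elements of \<open>S\<close> are allowed on purpose: with
  \<open>h\<close> the identity, S is seen to lie in a single left coset of
  \<open>heart K r'\<close>.\<close>

lemma conj_mem_heart:
  assumes r: "pre_extender K r" and r': "pre_extender K r'" and S: "friendly K r r' S"
    and "\<sigma> \<in> S" "\<tau> \<in> S" "h \<in> heart K r"
  shows "inv\<^bsub>A\<^esub> \<sigma> \<otimes>\<^bsub>A\<^esub> h \<otimes>\<^bsub>A\<^esub> \<tau> \<in> heart K r'"
proof -
  have "friendly K r' r' (m_inv A ` S <#>\<^bsub>A\<^esub> heart K r <#>\<^bsub>A\<^esub> S)"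
    by (intro friendly_set_mult[where r' = r] friendly_inverse friendly_heart S r r')
  from heart_upper[OF this] show ?thesis using assms(4-) by (auto simp: set_mult_def)
qed

lemma conj_heart:
  assumes r: "pre_extender K r" and r': "pre_extender K r'" and S: "friendly K r r' S"
    and t: "\<tau> \<in> S"
  shows "conj_set A (heart K r) \<tau> = heart K r'"
proof
  show "conj_set A (heart K r) \<tau> \<subseteq> heart K r'"
    using conj_mem_heart[OF r r' S t t] by (auto simp: conj_set_def)
  have tA: "\<tau> \<in> carrier A" using S t friendly_subset by blast
  show "heart K r' \<subseteq> conj_set A (heart K r) \<tau>"
  proof
    fix h assume h: "h \<in> heart K r'"
    then have hA: "h \<in> carrier A" using friendly_heart friendly_subset by blast
    \<comment> \<open>The first inclusion is reversed by using S^-1, which is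
      \<open>(r', r)\<close>-friendly, with the inverse of \<open>\<tau>\<close> in both places;
      hence the double inverse.\<close>
    have "inv\<^bsub>A\<^esub> (inv\<^bsub>A\<^esub> \<tau>) \<otimes>\<^bsub>A\<^esub> h \<otimes>\<^bsub>A\<^esub> inv\<^bsub>A\<^esub> \<tau> \<in> heart K r"
      by (rule conj_mem_heart[OF r' r friendly_inverse[OF S r]]) (use t h in auto)
    then have "\<tau> \<otimes>\<^bsub>A\<^esub> h \<otimes>\<^bsub>A\<^esub> inv\<^bsub>A\<^esub> \<tau> \<in> heart K r" using tA by simp
    moreover have "inv\<^bsub>A\<^esub> \<tau> \<otimes>\<^bsub>A\<^esub> (\<tau> \<otimes>\<^bsub>A\<^esub> h \<otimes>\<^bsub>A\<^esub> inv\<^bsub>A\<^esub> \<tau>) \<otimes>\<^bsub>A\<^esub> \<tau> = h"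
      using tA hA by (simp add: aut.m_assoc) (simp flip: aut.m_assoc)
    ultimately show "h \<in> conj_set A (heart K r) \<tau>" unfolding conj_set_def by (metis imageI)
  qed
qed

section \<open>Orbits and equality of quotient premaniplexes\<close>

lemma orbit_of_mem:
  assumes "subgroup H A" "h \<in> H" "\<Phi> \<in> flags K"
  shows "orbit_of H (h \<Phi>) = orbit_of H \<Phi>"
proof
  have H: "H \<subseteq> carrier A" using assms(1) by (rule subgroup.subset)
  show "orbit_of H (h \<Phi>) \<subseteq> orbit_of H \<Phi>"
    using assms by (auto simp: orbit_of_def image_iff simp flip: aut_mult
        intro: subgroup.m_closed)
  have "g \<Phi> = (inv\<^bsub>A\<^esub> h \<otimes>\<^bsub>A\<^esub> g) (h \<Phi>)" if "g \<in> H" for g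
    using assms H that by (subst aut_mult) (auto simp: aut_closed aut_inv)
  then show "orbit_of H \<Phi> \<subseteq> orbit_of H (h \<Phi>)"
    using assms unfolding orbit_of_def
    by (fast intro: subgroup.m_closed subgroup.m_inv_closed)
qed

text \<open>By \<open>conj_heart\<close> both quotients are by the same group, and the colours below
  \<open>mrank K\<close> agree. For the new colour, \<open>conj_extender K r \<tau> \<Phi>\<close>
  and \<open>r' \<Phi>\<close> differ by \<tau>^-1\<sigma> with \<sigma> in S, an element of
  \<open>heart K r'\<close>.\<close>

lemma friendly_imp_quotient_eq:
  assumes r: "pre_extender K r" and r': "pre_extender K r'" and S: "friendly K r r' S"
    and t: "\<tau> \<in> S"
  shows "quotient_graph (pre_extension K (conj_extender K r \<tau>)) (conj_set A (heart K r) \<tau>)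
       = quotient_graph (pre_extension K r') (heart K r')"
proof -
  let ?H = "heart K r'"
  have tA: "\<tau> \<in> carrier A" using S t friendly_subset by blast
  have r_eq: "orbit_of ?H (conj_extender K r \<tau> \<Phi>) = orbit_of ?H (r' \<Phi>)" if \<Phi>: "\<Phi> \<in> flags K" for \<Phi>
  proof -
    let ?\<Psi> = "(inv\<^bsub>A\<^esub> \<tau>) \<Phi>"
    have \<Psi>: "?\<Psi> \<in> flags K" using tA \<Phi> by (simp add: aut_closed)
    then obtain \<sigma> where s: "\<sigma> \<in> S" "\<sigma> \<in> carrier A" "r' (\<tau> ?\<Psi>) = \<sigma> (r ?\<Psi>)"
      by (rule friendlyE[OF S _ t])
    have "r' \<Phi> = (inv\<^bsub>A\<^esub> \<tau> \<otimes>\<^bsub>A\<^esub> \<sigma>) (conj_extender K r \<tau> \<Phi>)"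
      using s \<Phi> \<Psi> tA r by (simp add: aut_inv aut_mult conj_extender_def aut_closed extender_closed)
    moreover have "inv\<^bsub>A\<^esub> \<tau> \<otimes>\<^bsub>A\<^esub> \<sigma> \<in> ?H"
      using conj_mem_heart[OF r r' S t s(1) one_in_heart[OF r]] tA by simp
    moreover have "conj_extender K r \<tau> \<Phi> \<in> flags K"
      using \<Psi> tA r by (simp add: conj_extender_def aut_closed extender_closed)
    ultimately show ?thesis using orbit_of_mem[OF subgroup_heart[OF r']] by simp
  qed
  have sub: "X \<subseteq> flags K" if "X \<in> orbit_of ?H ` flags K" for X
    using that friendly_subset[OF friendly_heart, of r'] by (auto simp: orbit_of_def aut_closed)
  have "(\<Union>\<Phi>\<in>X. orbit_of ?H (conj_extender K r \<tau> \<Phi>)) = (\<Union>\<Phi>\<in>X. orbit_of ?H (r' \<Phi>))"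
    if "X \<in> orbit_of ?H ` flags K" for X
    using r_eq sub[OF that] by blast
  then show ?thesis
    unfolding conj_heart[OF assms] quotient_graph_def
    by (simp add: pre_extension_def fun_eq_iff restrict_def)
qed

text \<open>Equal adjacencies of the new colour place \<open>\<tau> (r \<Phi>)\<close> in the orbit
  of \<open>r' (\<tau> \<Phi>)\<close>, which is friendliness up to an element of the heart.
  Equality of the two groups is never derived; only their orbits are compared.\<close>

lemma quotient_eq_imp_friendly:
  assumes r: "pre_extender K r" and r': "pre_extender K r'" and t: "\<tau> \<in> carrier A"
    and eq: "quotient_graph (pre_extension K (conj_extender K r \<tau>)) (conj_set A (heart K r) \<tau>)
       = quotient_graph (pre_extension K r') (heart K r')" (is "?Q = ?Q'")
  shows "friendly K r r' ({\<tau>} <#>\<^bsub>A\<^esub> heart K r')"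
  unfolding friendly_def
proof (intro conjI ballI)
  let ?H = "heart K r'" and ?C = "conj_set A (heart K r) \<tau>"
  have sub: "subgroup ?H A" using r' by (rule subgroup_heart)
  have HA: "?H \<subseteq> carrier A" using sub by (rule subgroup.subset)
  then show "{\<tau>} <#>\<^bsub>A\<^esub> ?H \<subseteq> carrier A" using t by (auto simp: set_mult_def)
  have "\<one>\<^bsub>A\<^esub> = inv\<^bsub>A\<^esub> \<tau> \<otimes>\<^bsub>A\<^esub> \<one>\<^bsub>A\<^esub> \<otimes>\<^bsub>A\<^esub> \<tau>" using t by simp
  then have oneC: "\<one>\<^bsub>A\<^esub> \<in> ?C" using one_in_heart[OF r] unfolding conj_set_def by (rule image_eqI)
  have "flags ?Q = flags ?Q'" using eq by simp
  then have flags_eq: "orbit_of ?C ` flags K = orbit_of ?H ` flags K"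
    by (simp add: quotient_graph_def pre_extension_def)
  fix \<Phi> \<rho> assume \<Phi>: "\<Phi> \<in> flags K" and "\<rho> \<in> {\<tau>} <#>\<^bsub>A\<^esub> ?H"
  then obtain h where h: "h \<in> ?H" "\<rho> = \<tau> \<otimes>\<^bsub>A\<^esub> h" by (auto simp: set_mult_def)
  define \<Psi> where "\<Psi> = \<tau> \<Phi>"
  have \<Psi>: "\<Psi> \<in> flags K" using \<Phi> t by (simp add: \<Psi>_def aut_closed)
  have conj: "conj_extender K r \<tau> \<Psi> = \<tau> (r \<Phi>)" using \<Phi> t by (simp add: \<Psi>_def conj_extender_def aut_inv)
  have r\<Phi>: "r \<Phi> \<in> flags K" "\<tau> (r \<Phi>) \<in> flags K" using \<Phi> r t by (simp_all add: extender_closed aut_closed)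
  let ?X = "orbit_of ?H \<Psi>"
  have X: "?X \<in> orbit_of ?C ` flags K" unfolding flags_eq using \<Psi> by blast
  have "\<Psi> \<in> ?X"
    unfolding orbit_of_def by (rule image_eqI[where x = "\<one>\<^bsub>A\<^esub>"]) (use \<Psi> one_in_heart[OF r'] in \<open>simp_all add: aut_one\<close>)
  moreover have "\<tau> (r \<Phi>) \<in> orbit_of ?C (conj_extender K r \<tau> \<Psi>)"
    unfolding orbit_of_def by (rule image_eqI[where x = "\<one>\<^bsub>A\<^esub>"]) (use r\<Phi> oneC in \<open>simp_all add: conj aut_one\<close>)
  \<comment> \<open>In \<open>?Q\<close> only membership in the union defining \<open>adj\<close> is
    used, with representative \<open>\<Psi>\<close>; in \<open>?Q'\<close> the union is evaluated by
    \<open>adj_quotient\<close>.\<close>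
  ultimately have "\<tau> (r \<Phi>) \<in> adj ?Q (mrank K) ?X"
    using X by (auto simp: quotient_graph_def pre_extension_def)
  also have "adj ?Q (mrank K) ?X = orbit_of ?H (r' \<Psi>)"
    unfolding eq using adj_quotient[OF premaniplex r' sub friendly_heart _ \<Psi>, of "mrank K"]
    by (simp add: pre_extension_def)
  finally obtain g where g: "g \<in> ?H" "\<tau> (r \<Phi>) = g (r' \<Psi>)" by (auto simp: orbit_of_def)
  then have g': "r' \<Psi> = (inv\<^bsub>A\<^esub> g) (\<tau> (r \<Phi>))"
    using HA \<Psi> r' by (auto simp: aut_inv extender_closed)
  obtain h' where h': "h' \<in> ?H" "r' (h \<Psi>) = h' (r' \<Psi>)"
    using friendly_heart \<Psi> h(1) by (rule friendlyE)
  \<comment> \<open>The inverse of \<open>g\<close> undoes the choice within the orbit;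
    \<open>h'\<close> arises from moving \<open>h\<close> past \<open>r'\<close> by friendliness of
    the heart.\<close>
  let ?k = "inv\<^bsub>A\<^esub> g \<otimes>\<^bsub>A\<^esub> h'"
  have "?k \<in> ?H" using sub g h' by (simp add: subgroup.m_closed subgroup.m_inv_closed)
  moreover have "r' (\<rho> \<Phi>) = (\<tau> \<otimes>\<^bsub>A\<^esub> ?k) (r \<Phi>)"
    using \<Phi> r\<Phi> h' g' by (simp add: h(2) aut_mult \<Psi>_def)
  ultimately show "\<exists>\<rho>'\<in>{\<tau>} <#>\<^bsub>A\<^esub> ?H. r' (\<rho> \<Phi>) = \<rho>' (r \<Phi>)"
    by (auto simp: set_mult_def)
qed

section \<open>Universal Cayley extensions\<close>

abbreviation W :: "('f set \<times> bool) list set" where "W \<equiv> lists (facets K \<times> UNIV)"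

abbreviation cls :: "('f \<Rightarrow> 'f) \<Rightarrow> ('f set \<times> bool) list \<Rightarrow> ('f set \<times> bool) list set" where
  "cls r w \<equiv> word_rel (facets K) (ext_relators K r) `` {w}"

lemma group_ext_group: "group (ext_group K r)"
  unfolding ext_group_def by (rule group_presented_group)

lemma carrier_ext_group: "carrier (ext_group K r) = cls r ` W"
  by (auto simp: ext_group_def presented_group_def quotient_def)

lemma one_ext_group: "\<one>\<^bsub>ext_group K r\<^esub> = cls r []"
  by (simp add: ext_group_def presented_group_def)

lemma ext_gen_mult:
  "F \<in> facets K \<Longrightarrow> w \<in> W \<Longrightarrow> ext_gen K r F \<otimes>\<^bsub>ext_group K r\<^esub> cls r w = cls r ((F, True) # w)"
  unfolding ext_gen_def generator_def ext_group_def by (subst mult_presented_group) auto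

lemma ext_gen_closed: "F \<in> facets K \<Longrightarrow> ext_gen K r F \<in> carrier (ext_group K r)"
  unfolding carrier_ext_group ext_gen_def generator_def by (intro imageI) auto

lemma facet_of_facets: "\<Phi> \<in> flags K \<Longrightarrow> facet_of K \<Phi> \<in> facets K"
  by (simp add: facets_def)

lemma cls_cong: "(v, w) \<in> word_rel (facets K) (ext_relators K r) \<Longrightarrow> cls r v = cls r w"
  by (rule equiv_class_eq[OF equiv_word_rel])

lemma cls_relator:
  assumes r: "pre_extender K r" and F: "F \<in> facets K" and w: "w \<in> W"
  shows "cls r ((F, True) # (r ` F, True) # w) = cls r w"
  using word_rel.word_relator[of "[]" "facets K" w "[(F, True), (r ` F, True)]" "ext_relators K r"]
    F w extender_facets[OF r F] by (intro cls_cong) (auto simp: ext_relators_def)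

text \<open>Insert the relator of F after the inverse letter and cancel. Inverse letters thus become
  positive ones, so inductions on words only have to handle generators.\<close>

lemma cls_False:
  assumes r: "pre_extender K r" and F: "F \<in> facets K" and w: "w \<in> W"
  shows "cls r ((F, False) # w) = cls r ((r ` F, True) # w)"
proof -
  have rF: "r ` F \<in> facets K" using r F by (rule extender_facets)
  have "([(F, False)] @ [(F, True), (r ` F, True)] @ w, [(F, False)] @ w) \<in>
      word_rel (facets K) (ext_relators K r)"
    by (rule word_rel.word_relator) (use F w rF in \<open>auto simp: ext_relators_def\<close>)
  moreover have "([] @ [(F, False), (F, \<not> False)] @ (r ` F, True) # w, [] @ (r ` F, True) # w) \<in>
      word_rel (facets K) (ext_relators K r)"
    by (rule word_rel.word_cancel) (use F w rF in auto)
  ultimately show ?thesis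
    by (intro cls_cong) (auto intro: word_rel.word_sym word_rel.word_trans)
qed

text \<open>Apply the relator of the facet r(F), whose second letter is F because \<open>r\<close>
  is an involution on facets.\<close>

lemma ext_gen_inverse:
  assumes r: "pre_extender K r" and F: "F \<in> facets K" and g: "\<gamma> \<in> carrier (ext_group K r)"
  shows "ext_gen K r (r ` F) \<otimes>\<^bsub>ext_group K r\<^esub> (ext_gen K r F \<otimes>\<^bsub>ext_group K r\<^esub> \<gamma>) = \<gamma>"
proof -
  obtain w where w: "w \<in> W" "\<gamma> = cls r w" using g by (auto simp: carrier_ext_group)
  have rF: "r ` F \<in> facets K" using r F by (rule extender_facets)
  have "(F, True) # w \<in> W" using F w by auto
  then show ?thesis
    using cls_relator[OF r rF w(1)] w F rF extender_facets_invol[OF r F] by (simp add: ext_gen_mult)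
qed

section \<open>Connectedness of the universal extension and rigidity of its endomorphisms\<close>

lemma extension_sel:
  "mrank (universal_extension K r) = Suc (mrank K)"
  "flags (universal_extension K r) = flags K \<times> carrier (ext_group K r)"
  "i < mrank K \<Longrightarrow> adj (universal_extension K r) i (\<Phi>, \<gamma>) = (adj K i \<Phi>, \<gamma>)"
  "adj (universal_extension K r) (mrank K) (\<Phi>, \<gamma>) =
     (r \<Phi>, ext_gen K r (facet_of K \<Phi>) \<otimes>\<^bsub>ext_group K r\<^esub> \<gamma>)"
  by (simp_all add: universal_extension_def)

text \<open>This is connectedness of the universal extension. Call the flags with a fixed group
  element a layer: connectedness of \<open>K\<close> moves within a layer, and induction on a word
  changes layers one letter at a time.\<close>

lemma extension_induct [consumes 3, case_names base step]:
  assumes r: "pre_extender K r" and \<Phi>: "\<Phi> \<in> flags K"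
    and x: "x \<in> flags (universal_extension K r)"
    and base: "P (\<Phi>, \<one>\<^bsub>ext_group K r\<^esub>)"
    and step: "\<And>x i. x \<in> flags (universal_extension K r) \<Longrightarrow> i \<le> mrank K \<Longrightarrow> P x \<Longrightarrow>
      P (adj (universal_extension K r) i x)"
  shows "P x"
proof -
  have layer: "P (\<Psi>', \<gamma>)"
    if "P (\<Psi>, \<gamma>)" "\<Psi> \<in> flags K" "\<Psi>' \<in> flags K" "\<gamma> \<in> carrier (ext_group K r)" for \<Psi> \<Psi>' \<gamma>
    using that(2,3)
  proof (induction rule: flags_induct)
    case (step \<Psi> i)
    then show ?case using assms(5)[of "(\<Psi>, \<gamma>)" i] that(4) by (simp add: extension_sel)
  qed (fact that)
  \<comment> \<open>At a flag \<open>\<Xi>\<close> of \<open>F\<close> the edge of colour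
    \<open>mrank K\<close> leads from the layer of \<open>w\<close> to \<open>r \<Xi>\<close> in the
    layer of \<open>(F, True) # w\<close>; \<open>layer\<close> then covers all of the new
    layer.\<close>
  have gen: "P (\<Psi>, cls r ((F, True) # w))"
    if IH: "\<And>\<Psi>. \<Psi> \<in> flags K \<Longrightarrow> P (\<Psi>, cls r w)" and w: "w \<in> W" and F: "F \<in> facets K"
      and \<Psi>: "\<Psi> \<in> flags K" for F w \<Psi>
  proof -
    obtain \<Xi> where \<Xi>: "\<Xi> \<in> flags K" "F = facet_of K \<Xi>" using F by (auto simp: facets_def)
    have "P (r \<Xi>, cls r ((F, True) # w))"
      using step[of "(\<Xi>, cls r w)" "mrank K"] IH[OF \<Xi>(1)] \<Xi> w F
      by (simp add: extension_sel ext_gen_mult carrier_ext_group)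
    moreover have "(F, True) # w \<in> W" using F w by auto
    ultimately show ?thesis using layer \<Psi> \<Xi> r by (auto simp: carrier_ext_group extender_closed)
  qed
  have "P (\<Psi>, cls r w)" if "w \<in> W" "\<Psi> \<in> flags K" for w \<Psi>
    using that
  proof (induction w arbitrary: \<Psi>)
    case Nil
    have "cls r [] \<in> carrier (ext_group K r)" by (auto simp: carrier_ext_group)
    then show ?case using layer[of \<Phi> "cls r []" \<Psi>] base \<Phi> Nil by (simp add: one_ext_group)
  next
    case (Cons l w)
    obtain F b where l: "l = (F, b)" by force
    have F: "F \<in> facets K" and w: "w \<in> W" using Cons.hyps by (simp_all add: l)
    have IH: "P (\<Psi>, cls r w)" if "\<Psi> \<in> flags K" for \<Psi> using Cons.IH w that by blast
    show ?case
    proof (cases b)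
      case True
      then show ?thesis using gen[OF IH w F] Cons.prems l by simp
    next
      case False
      then show ?thesis
        using gen[OF IH w extender_facets[OF r F]] Cons.prems l cls_False[OF r F w] by simp
    qed
  qed
  then show ?thesis using x by (auto simp: extension_sel carrier_ext_group)
qed

text \<open>The fixed flags of \<open>f\<close> are closed under all adjacencies and include a base
  flag.\<close>

lemma extension_endo_id:
  assumes r: "pre_extender K r" and \<Phi>: "\<Phi> \<in> flags K"
    and f: "f \<in> graph_hom (universal_extension K r) (universal_extension K r)"
    and fix1: "f (\<Phi>, \<one>\<^bsub>ext_group K r\<^esub>) = (\<Phi>, \<one>\<^bsub>ext_group K r\<^esub>)"
    and x: "x \<in> flags (universal_extension K r)"
  shows "f x = x"
  using r \<Phi> x by (induction rule: extension_induct)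
    (use fix1 f in \<open>auto simp: graph_hom_def extension_sel(1) less_Suc_eq_le\<close>)

lemma extension_iso_imp_friendly:
  assumes r: "pre_extender K r"
    and iso: "\<phi> \<in> graph_iso (universal_extension K r) (universal_extension K r')"
  shows "\<exists>S. S \<noteq> {} \<and> friendly K r r' S"
proof -
  let ?U = "universal_extension K r" and ?U' = "universal_extension K r'"
  let ?G = "ext_group K r"
  \<comment> \<open>The automorphism of \<open>K\<close> induced on the layer of
    \<open>\<gamma>\<close>, restricted because members of \<open>aut_group\<close> are
    extensional.\<close>
  define t where "t \<gamma> = (\<lambda>\<Phi>\<in>flags K. fst (\<phi> (\<Phi>, \<gamma>)))" for \<gamma>
  have bij: "bij_betw \<phi> (flags ?U) (flags ?U')"
    and adj: "\<And>i x. i \<le> mrank K \<Longrightarrow> x \<in> flags ?U \<Longrightarrow> \<phi> (adj ?U i x) = adj ?U' i (\<phi> x)"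
    using iso by (auto simp: graph_iso_def extension_sel(1) less_Suc_eq_le)
  have closed: "\<phi> (\<Phi>, \<gamma>) \<in> flags K \<times> carrier (ext_group K r')"
    if "\<Phi> \<in> flags K" "\<gamma> \<in> carrier ?G" for \<Phi> \<gamma>
    using bij that by (auto simp: bij_betw_def extension_sel)
  have \<phi>_adj: "\<phi> (adj K i \<Phi>, \<gamma>) = (adj K i (fst (\<phi> (\<Phi>, \<gamma>))), snd (\<phi> (\<Phi>, \<gamma>)))"
    if "i < mrank K" "\<Phi> \<in> flags K" "\<gamma> \<in> carrier ?G" for i \<Phi> \<gamma>
    using adj[of i "(\<Phi>, \<gamma>)"] that by (cases "\<phi> (\<Phi>, \<gamma>)") (simp add: extension_sel)
  \<comment> \<open>Colours below \<open>mrank K\<close> preserve the second coordinate, so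
    \<open>\<phi>\<close> sends a layer into a single layer.\<close>
  have snd_eq: "snd (\<phi> (\<Psi>, \<gamma>)) = snd (\<phi> (\<Phi>, \<gamma>))"
    if "\<Phi> \<in> flags K" "\<Psi> \<in> flags K" "\<gamma> \<in> carrier ?G" for \<Phi> \<Psi> \<gamma>
    using that(1,2) by (induction rule: flags_induct) (use that in \<open>simp_all add: \<phi>_adj\<close>)
  have tA: "t \<gamma> \<in> carrier A" if g: "\<gamma> \<in> carrier ?G" for \<gamma>
  proof -
    have t_adj: "t \<gamma> (adj K i \<Phi>) = adj K i (t \<gamma> \<Phi>)" if "i < mrank K" "\<Phi> \<in> flags K" for i \<Phi>
      using that g by (simp add: t_def adj_closed \<phi>_adj)
    have t_closed: "t \<gamma> \<Phi> \<in> flags K" if "\<Phi> \<in> flags K" for \<Phi>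
      using closed[OF that g] that by (auto simp: t_def)
    have "inj_on (t \<gamma>) (flags K)"
    proof (rule inj_onI)
      fix \<Phi> \<Psi> assume *: "\<Phi> \<in> flags K" "\<Psi> \<in> flags K" "t \<gamma> \<Phi> = t \<gamma> \<Psi>"
      then have "\<phi> (\<Phi>, \<gamma>) = \<phi> (\<Psi>, \<gamma>)"
        using snd_eq[OF *(1,2) g] by (simp add: t_def prod_eq_iff)
      then show "\<Phi> = \<Psi>" using bij * g by (auto simp: bij_betw_def inj_on_def extension_sel)
    qed
    moreover have "t \<gamma> ` flags K = flags K"
    proof
      show "t \<gamma> ` flags K \<subseteq> flags K" using t_closed by blast
      obtain \<Phi> where \<Phi>: "\<Phi> \<in> flags K" using connected by (auto simp: connected_graph_def)
      \<comment> \<open>The image is non-empty and closed under adjacency, hence everything by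
        connectedness.\<close>
      show "flags K \<subseteq> t \<gamma> ` flags K"
      proof
        fix \<Psi> assume "\<Psi> \<in> flags K"
        with t_closed[OF \<Phi>] show "\<Psi> \<in> t \<gamma> ` flags K"
        proof (induction rule: flags_induct)
          case base
          show ?case using \<Phi> by blast
        next
          case (step \<Psi> i)
          then obtain \<Xi> where "\<Xi> \<in> flags K" "\<Psi> = t \<gamma> \<Xi>" by blast
          then show ?case using step(2) by (auto simp: adj_closed simp flip: t_adj)
        qed
      qed
    qed
    ultimately show ?thesis
      using t_adj by (auto simp: aut_group_def Bij_def graph_iso_def bij_betw_def t_def)
  qed
  have "friendly K r r' (t ` carrier ?G)"
    unfolding friendly_def
  proof (intro conjI ballI)
    show "t ` carrier ?G \<subseteq> carrier A" using tA by blast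
    fix \<Phi> \<tau> assume \<Phi>: "\<Phi> \<in> flags K" and "\<tau> \<in> t ` carrier ?G"
    then obtain \<gamma> where g: "\<gamma> \<in> carrier ?G" "\<tau> = t \<gamma>" by blast
    \<comment> \<open>The companion of \<open>t \<gamma>\<close> at \<open>\<Phi>\<close> is the
      automorphism of the layer reached from \<open>(\<Phi>, \<gamma>)\<close> along the new
      edge.\<close>
    let ?\<gamma> = "ext_gen K r (facet_of K \<Phi>) \<otimes>\<^bsub>?G\<^esub> \<gamma>"
    have g': "?\<gamma> \<in> carrier ?G"
      using g \<Phi> group_ext_group by (metis ext_gen_closed facet_of_facets group.is_monoid monoid.m_closed)
    have "fst (\<phi> (r \<Phi>, ?\<gamma>)) = r' (fst (\<phi> (\<Phi>, \<gamma>)))"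
      using adj[of "mrank K" "(\<Phi>, \<gamma>)"] \<Phi> g by (cases "\<phi> (\<Phi>, \<gamma>)") (simp add: extension_sel)
    then have "r' (\<tau> \<Phi>) = t ?\<gamma> (r \<Phi>)" using \<Phi> r g by (simp add: t_def extender_closed)
    then show "\<exists>\<tau>'\<in>t ` carrier ?G. r' (\<tau> \<Phi>) = \<tau>' (r \<Phi>)" using g' by blast
  qed
  moreover have "t ` carrier ?G \<noteq> {}" by (auto simp: carrier_ext_group)
  ultimately show ?thesis by (intro exI conjI)
qed

end

section \<open>The group action defined by a friendly set\<close>

text \<open>
  For \<open>\<tau> \<in> S\<close> and a facet \<open>F\<close>, the element \<open>bar F \<tau>\<close> of \<open>S\<close> satisfies
  \<open>r' (\<Phi>\<tau>) = (r \<Phi>) (bar F \<tau>)\<close> simultaneously for all flags \<open>\<Phi>\<close> of \<open>F\<close>. Hence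
  \<open>\<alpha>\<^sub>F (\<tau>, \<gamma>) = (bar F \<tau>, \<alpha>\<^sub>F\<^sub>\<tau> \<gamma>)\<close> is a left action of the group of \<open>r\<close> on pairs of an
  element of \<open>S\<close> and an element of the group of \<open>r'\<close>.
\<close>

locale friendly_extenders = connected_premaniplex K
  for K :: "('f, 'm) colored_graph_scheme" +
  fixes r r' :: "'f \<Rightarrow> 'f" and S :: "('f \<Rightarrow> 'f) set"
  assumes r: "pre_extender K r" and r': "pre_extender K r'" and S: "friendly K r r' S"
begin

definition bar :: "'f set \<Rightarrow> ('f \<Rightarrow> 'f) \<Rightarrow> ('f \<Rightarrow> 'f)" where
  "bar F \<tau> = (SOME \<sigma>. \<sigma> \<in> S \<and> (\<forall>\<Phi>\<in>F. r' (\<tau> \<Phi>) = \<sigma> (r \<Phi>)))"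

lemma S_aut: "\<tau> \<in> S \<Longrightarrow> \<tau> \<in> carrier A"
  using S friendly_subset by blast

text \<open>Choose the automorphism for one flag of F. The equation spreads over F because
  automorphisms and both pre-extenders commute with the colours spanning a facet.\<close>

lemma bar:
  assumes F: "F \<in> facets K" and t: "\<tau> \<in> S"
  shows "bar F \<tau> \<in> S" "\<And>\<Phi>. \<Phi> \<in> F \<Longrightarrow> r' (\<tau> \<Phi>) = bar F \<tau> (r \<Phi>)"
proof -
  obtain \<Phi> where \<Phi>: "\<Phi> \<in> flags K" "F = facet_of K \<Phi>" using F by (auto simp: facets_def)
  obtain \<sigma> where s: "\<sigma> \<in> S" "\<sigma> \<in> carrier A" "r' (\<tau> \<Phi>) = \<sigma> (r \<Phi>)"
    using S \<Phi>(1) t by (rule friendlyE)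
  have "r' (\<tau> \<Psi>) = \<sigma> (r \<Psi>)" if "\<Psi> \<in> F" for \<Psi>
    using that s(3) unfolding \<Phi>(2) facet_of_def
  proof (induction rule: component_induct)
    case (step \<Psi> i)
    then show ?case
      using s S_aut[OF t] r r' by (simp add: aut_adj aut_closed extender_adj extender_closed)
  qed
  then have "\<exists>\<sigma>. \<sigma> \<in> S \<and> (\<forall>\<Phi>\<in>F. r' (\<tau> \<Phi>) = \<sigma> (r \<Phi>))" using s by blast
  from someI_ex[OF this]
  show "bar F \<tau> \<in> S" "\<And>\<Phi>. \<Phi> \<in> F \<Longrightarrow> r' (\<tau> \<Phi>) = bar F \<tau> (r \<Phi>)" by (auto simp: bar_def)
qed

fun act1 where
  "act1 F (\<tau>, \<gamma>) = (bar F \<tau>, ext_gen K r' (\<tau> ` F) \<otimes>\<^bsub>ext_group K r'\<^esub> \<gamma>)"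

abbreviation D where "D \<equiv> S \<times> carrier (ext_group K r')"

lemma aut_facets: "\<tau> \<in> S \<Longrightarrow> F \<in> facets K \<Longrightarrow> \<tau> ` F \<in> facets K"
  by (auto simp: facets_def aut_facet S_aut aut_closed)

lemma act1_closed:
  assumes "F \<in> facets K" "p \<in> D"
  shows "act1 F p \<in> D"
proof -
  interpret G: group "ext_group K r'" by (rule group_ext_group)
  show ?thesis using assms by (cases p) (auto simp: bar aut_facets ext_gen_closed)
qed

text \<open>This is the relator of F checked on the action. The first coordinates agree at one flag,
  hence everywhere by \<open>aut_eqI\<close>; the second coordinates agree by a relator of the group
  of \<open>r'\<close>.\<close>

lemma act1_inverse:
  assumes F: "F \<in> facets K" and p: "p \<in> D"
  shows "act1 (r ` F) (act1 F p) = p"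
proof -
  obtain \<tau> \<gamma> where p_eq: "p = (\<tau>, \<gamma>)" and t: "\<tau> \<in> S" and g: "\<gamma> \<in> carrier (ext_group K r')"
    using p by auto
  obtain \<Phi> where \<Phi>: "\<Phi> \<in> flags K" "\<Phi> \<in> F"
    using F component_self by (fastforce simp: facets_def facet_of_def)
  have rF: "r ` F \<in> facets K" using r F by (rule extender_facets)
  note b = bar[OF F t]
  note bb = bar[OF rF b(1)]
  have "bar (r ` F) (bar F \<tau>) \<Phi> = r' (bar F \<tau> (r \<Phi>))" using bb(2)[of "r \<Phi>"] \<Phi> r by (simp add: extender_invol)
  also have "\<dots> = \<tau> \<Phi>" using b(2) \<Phi> r' t by (simp flip: b(2) add: extender_invol aut_closed S_aut)
  finally have "bar (r ` F) (bar F \<tau>) = \<tau>" using aut_eqI S_aut bb(1) t \<Phi>(1) by blast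
  \<comment> \<open>The letter contributed by the second factor is thus the facet paired by
    \<open>r'\<close> with the image of F under \<open>\<tau>\<close>, as
    \<open>ext_gen_inverse\<close> requires.\<close>
  moreover have "bar F \<tau> ` r ` F = r' ` \<tau> ` F" using b(2) by (force simp: image_image)
  ultimately show ?thesis
    using ext_gen_inverse[OF r' aut_facets[OF t F] g] by (simp add: p_eq)
qed

lemma act1_inverse':
  assumes "F \<in> facets K" "p \<in> D"
  shows "act1 F (act1 (r ` F) p) = p"
  using act1_inverse[OF extender_facets[OF r assms(1)] assms(2)] extender_facets_invol[OF r assms(1)]
  by simp

text \<open>Inverse letters act through r(F), as the relators dictate; \<open>foldr\<close> lets the
  first letter act last, which gives a left action.\<close>

definition act where
  "act w p = foldr (\<lambda>(F, b). act1 (if b then F else r ` F)) w p"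

lemma act_simps [simp]:
  "act [] p = p"
  "act ((F, b) # w) p = act1 (if b then F else r ` F) (act w p)"
  "act (u @ v) p = act u (act v p)"
  by (simp_all add: act_def)

lemma act_closed: "w \<in> W \<Longrightarrow> p \<in> D \<Longrightarrow> act w p \<in> D"
  by (induction w) (auto simp del: act1.simps intro!: act1_closed extender_facets r split: if_splits)

text \<open>The action descends to the group: a cancelling pair and a relator both act as F and r(F)
  in one order or the other, hence trivially on \<open>D\<close>.\<close>

lemma act_cong:
  assumes "(v, w) \<in> word_rel (facets K) (ext_relators K r)" "p \<in> D"
  shows "act v p = act w p"
  using assms
proof (induction arbitrary: p rule: word_rel.induct)
  case (word_cancel u v F b)
  then have "act v p \<in> D" by (intro act_closed)
  then show ?case
    using act1_inverse[OF word_cancel(3)] act1_inverse'[OF word_cancel(3)]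
    by (simp del: act1.simps)
next
  case (word_relator u v s)
  obtain F where F: "F \<in> facets K" "s = [(F, True), (r ` F, True)]"
    using word_relator(3) by (auto simp: ext_relators_def)
  have "act v p \<in> D" using word_relator by (intro act_closed)
  then show ?case using act1_inverse'[OF F(1)] F(2) by (simp del: act1.simps)
qed auto

text \<open>Let \<open>\<gamma>\<close> act on the pair of \<open>\<tau>\<close> and the identity;
  if the result is \<open>(\<sigma>, \<delta>)\<close>, send \<open>(\<Phi>, \<gamma>)\<close> to
  \<open>(\<sigma> \<Phi>, \<delta>)\<close>.\<close>

lemma friendly_imp_hom:
  assumes t: "\<tau> \<in> S"
  obtains \<phi> where "\<phi> \<in> graph_hom (universal_extension K r) (universal_extension K r')"
    "\<And>\<Phi>. \<Phi> \<in> flags K \<Longrightarrow> \<phi> (\<Phi>, \<one>\<^bsub>ext_group K r\<^esub>) = (\<tau> \<Phi>, \<one>\<^bsub>ext_group K r'\<^esub>)"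
proof
  let ?U = "universal_extension K r" and ?U' = "universal_extension K r'"
  define p where "p = (\<tau>, \<one>\<^bsub>ext_group K r'\<^esub>)"
  have p: "p \<in> D" using t group_ext_group[of r'] by (simp add: p_def group.is_monoid monoid.one_closed)
  define ev where "ev \<Phi> q = (fst q \<Phi>, snd q)" for \<Phi> and q :: "('f \<Rightarrow> 'f) \<times> ('f set \<times> bool) list set"
  \<comment> \<open>A group element is a class of words; by \<open>act_cong\<close> any word in it
    yields the same value.\<close>
  define \<phi> where "\<phi> = (\<lambda>(\<Phi>, \<gamma>). ev \<Phi> (act (SOME w. w \<in> \<gamma>) p))"
  have \<phi>: "\<phi> (\<Phi>, cls r w) = ev \<Phi> (act w p)" if "w \<in> W" for \<Phi> w
  proof -
    have "w \<in> cls r w" using that by (auto intro: word_rel.word_refl)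
    then have "(SOME v. v \<in> cls r w) \<in> cls r w" by (rule someI)
    then show ?thesis using act_cong[OF _ p, of w] by (simp add: \<phi>_def)
  qed
  show "\<phi> (\<Phi>, \<one>\<^bsub>ext_group K r\<^esub>) = (\<tau> \<Phi>, \<one>\<^bsub>ext_group K r'\<^esub>)" for \<Phi>
    using \<phi>[of "[]" \<Phi>] by (simp add: one_ext_group ev_def p_def)
  show "\<phi> \<in> graph_hom ?U ?U'"
    unfolding graph_hom_def
  proof (intro CollectI conjI allI ballI impI funcsetI)
    fix x assume "x \<in> flags ?U"
    then obtain \<Phi> w where x: "x = (\<Phi>, cls r w)" "\<Phi> \<in> flags K" "w \<in> W"
      by (auto simp: extension_sel carrier_ext_group)
    obtain \<sigma> \<gamma> where a: "act w p = (\<sigma>, \<gamma>)" "\<sigma> \<in> S" "\<gamma> \<in> carrier (ext_group K r')"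
      using act_closed[OF x(3) p] by auto
    show "\<phi> x \<in> flags ?U'" using x a by (simp add: \<phi> ev_def extension_sel aut_closed S_aut)
    fix i assume "i < mrank ?U"
    then consider "i < mrank K" | "i = mrank K" by (fastforce simp: extension_sel less_Suc_eq)
    then show "\<phi> (adj ?U i x) = adj ?U' i (\<phi> x)"
    proof cases
      case 1
      then show ?thesis using x a by (simp add: \<phi> ev_def extension_sel aut_adj S_aut)
    next
      case 2
      let ?F = "facet_of K \<Phi>"
      have F: "?F \<in> facets K" using x by (simp add: facet_of_facets)
      have \<Phi>: "\<Phi> \<in> ?F" by (simp add: facet_of_def component_self)
      have "(?F, True) # w \<in> W" using F x by auto
      then have "\<phi> (adj ?U i x) = ev (r \<Phi>) (act ((?F, True) # w) p)"
        using 2 x F by (simp add: extension_sel ext_gen_mult \<phi> del: act_simps)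
      \<comment> \<open>\<open>bar\<close> handles the flag, and \<open>aut_facet\<close> identifies
        the facet of \<open>\<sigma> \<Phi>\<close> with the image of \<open>?F\<close>, so the
        generators agree.\<close>
      also have "\<dots> = adj ?U' i (\<phi> x)"
        using 2 x a \<Phi> bar(2)[OF F a(2) \<Phi>] by (simp add: \<phi> ev_def extension_sel aut_facet S_aut)
      finally show ?thesis .
    qed
  qed (simp add: extension_sel)
qed

end

section \<open>Isomorphisms of universal extensions from friendly sets\<close>

context connected_premaniplex
begin

lemma friendly_imp_extension_iso:
  assumes r: "pre_extender K r" and r': "pre_extender K r'"
    and S: "friendly K r r' S" and t: "\<tau> \<in> S"
  shows "\<exists>\<phi>. \<phi> \<in> graph_iso (universal_extension K r) (universal_extension K r')"
proof -
  let ?U = "universal_extension K r" and ?U' = "universal_extension K r'"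
  have tA: "\<tau> \<in> carrier A" using S t friendly_subset by blast
  interpret f: friendly_extenders K r r' S
    by unfold_locales (fact r r' S)+
  interpret b: friendly_extenders K r' r "m_inv A ` S"
    by unfold_locales (fact r r' friendly_inverse[OF S r])+
  obtain \<phi> where \<phi>: "\<phi> \<in> graph_hom ?U ?U'"
    "\<And>\<Phi>. \<Phi> \<in> flags K \<Longrightarrow> \<phi> (\<Phi>, \<one>\<^bsub>ext_group K r\<^esub>) = (\<tau> \<Phi>, \<one>\<^bsub>ext_group K r'\<^esub>)"
    using f.friendly_imp_hom[OF t] by blast
  obtain \<psi> where \<psi>: "\<psi> \<in> graph_hom ?U' ?U"
    "\<And>\<Phi>. \<Phi> \<in> flags K \<Longrightarrow> \<psi> (\<Phi>, \<one>\<^bsub>ext_group K r'\<^esub>) = ((inv\<^bsub>A\<^esub> \<tau>) \<Phi>, \<one>\<^bsub>ext_group K r\<^esub>)"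
    using b.friendly_imp_hom[OF imageI[OF t]] by blast
  obtain \<Phi> where \<Phi>: "\<Phi> \<in> flags K" using connected by (auto simp: connected_graph_def)
  \<comment> \<open>The homomorphisms start from \<open>\<tau>\<close> and its inverse, so each
    composite fixes \<open>\<Phi>\<close> in the identity layer and rigidity applies.\<close>
  have "(\<psi> \<circ> \<phi>) x = x" if "x \<in> flags ?U" for x
    by (rule extension_endo_id[OF r \<Phi> graph_hom_compose[OF \<phi>(1) \<psi>(1)] _ that])
      (simp add: \<phi> \<psi> \<Phi> tA aut_closed aut_inv)
  moreover have "(\<phi> \<circ> \<psi>) y = y" if "y \<in> flags ?U'" for y
    by (rule extension_endo_id[OF r' \<Phi> graph_hom_compose[OF \<psi>(1) \<phi>(1)] _ that])
      (simp add: \<phi> \<psi> \<Phi> tA aut_closed aut_inv)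
  ultimately show ?thesis using graph_iso_of_inverse_homs[OF \<phi>(1) \<psi>(1)] by auto
qed

end

theorem theorem5p24:
  fixes K :: "'f colored_graph" and n :: nat and r r' :: "'f \<Rightarrow> 'f"
  assumes "maniplex n K"
    and "pre_extender K r"
    and "pre_extender K r'"
  shows "((\<exists>\<phi>. \<phi> \<in> graph_iso (universal_extension K r) (universal_extension K r')) \<longleftrightarrow>
          (\<exists>S. S \<noteq> {} \<and> friendly K r r' S))
       \<and> ((\<exists>S. S \<noteq> {} \<and> friendly K r r' S) \<longleftrightarrow>
          (\<exists>\<tau>\<in>carrier (aut_group K).
             quotient_graph (pre_extension K (conj_extender K r \<tau>))
                            (conj_set (aut_group K) (heart K r) \<tau>)
           = quotient_graph (pre_extension K r') (heart K r')))"
proof -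
  interpret connected_premaniplex K
    using assms(1) by unfold_locales (auto simp: maniplex_def premaniplex_def)
  note r = assms(2) and r' = assms(3)
  have "(\<exists>\<phi>. \<phi> \<in> graph_iso (universal_extension K r) (universal_extension K r')) \<longleftrightarrow>
      (\<exists>S. S \<noteq> {} \<and> friendly K r r' S)"
    using extension_iso_imp_friendly[OF r] friendly_imp_extension_iso[OF r r'] by blast
  \<comment> \<open>Any member of \<open>S\<close> serves as the automorphism
    \<open>\<tau>\<close>.\<close>
  moreover have "\<exists>\<tau>\<in>carrier A.
      quotient_graph (pre_extension K (conj_extender K r \<tau>)) (conj_set A (heart K r) \<tau>)
    = quotient_graph (pre_extension K r') (heart K r')" if "S \<noteq> {}" "friendly K r r' S" for S
    using that friendly_imp_quotient_eq[OF r r' that(2)] friendly_subset[OF that(2)] by blast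
  moreover have "\<exists>S. S \<noteq> {} \<and> friendly K r r' S" if "\<tau> \<in> carrier A"
    "quotient_graph (pre_extension K (conj_extender K r \<tau>)) (conj_set A (heart K r) \<tau>)
      = quotient_graph (pre_extension K r') (heart K r')" for \<tau>
  proof (intro exI conjI)
    show "friendly K r r' ({\<tau>} <#>\<^bsub>A\<^esub> heart K r')"
      using quotient_eq_imp_friendly[OF r r' that] .
    show "{\<tau>} <#>\<^bsub>A\<^esub> heart K r' \<noteq> {}"
      using one_in_heart[OF r'] by (auto simp: set_mult_def)
  qed
  ultimately show ?thesis by blast
qed

end
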